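(* Let $n\ge 2$ be an integer and let $k\ge -n$ be a real number. Then the polynomial $$P_n(x)=(x+1)A_{n-1}(x)+k\,x\,A_{n-2}(x)$$ is weakly Hurwitz stable, i.e. $P_n(z)\neq 0$ for every $z\in\mathbb{C}$ with $\Re z>0$.
   Context: For $m\ge 0$, $A_m(x)=\sum_{\sigma\in S_{m+1}} x^{\operatorname{des}\sigma}$ is the classical Eulerian polynomial (the Eulerian polynomial of the Coxeter group of type $A_m$, i.e. the symmetric group $S_{m+1}$), where $\operatorname{des}\sigma=|\{i\in[m]:\sigma(i)>\sigma(i+1)\}|$; in particular $A_0(x)=1$ and $\frac{A_{m-1}(x)}{(1-x)^{m+1}}=\sum_{i\ge0}(i+1)^m x^i$. A polynomial $P\in\mathbb{C}[z]$ is weakly Hurwitz stable if $P(z)\ne 0$ whenever $\Re z>0$. *)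

theory Defs
  imports
    Complex_Main
    "HOL-Computational_Algebra.Polynomial"
    "HOL-Combinatorics.Permutations"
begin

text \<open>The number of descents of a permutation of \<open>{1..m + 1}\<close>, in one-line notation.\<close>

definition perm_des :: "nat \<Rightarrow> (nat \<Rightarrow> nat) \<Rightarrow> nat" where
  "perm_des m \<sigma> = card {i \<in> {1..m}. \<sigma> i > \<sigma> (i + 1)}"

text \<open>
  Indexing is by Coxeter type: \<open>eulerian_poly m\<close> is the Eulerian polynomial of the
  symmetric group on \<open>m + 1\<close> letters, of degree \<open>m\<close>, with constant coefficient 1.
\<close>

definition eulerian_poly :: "nat \<Rightarrow> 'a :: comm_semiring_1 poly" where
  "eulerian_poly m = (\<Sum>\<sigma> | \<sigma> permutes {1..m + 1}. monom 1 (perm_des m \<sigma>))"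

definition weakly_hurwitz_stable :: "complex poly \<Rightarrow> bool" where
  "weakly_hurwitz_stable P \<longleftrightarrow> (\<forall>z. Re z > 0 \<longrightarrow> poly P z \<noteq> 0)"

end

theory Submission
  imports Defs "HOL-Computational_Algebra.Fundamental_Theorem_Algebra"
begin

text \<open>
  Inserting the largest letter gives the recurrence
  \<open>A\<^sub>m\<^sub>+\<^sub>1 = (1 + (m + 1) x) A\<^sub>m + x (1 - x) A\<^sub>m'\<close>.
  If \<open>A\<^sub>m\<close> has only negative roots \<open>r\<close>, then
  \<open>A\<^sub>m\<^sub>+\<^sub>1 / (z A\<^sub>m) = 1/z + (\<Sum>r. (1 - r) / (z - r)) + const\<close> has nonzero imaginary part at every
  non-real \<open>z\<close>, so \<open>A\<^sub>m\<^sub>+\<^sub>1\<close> is real-rooted as well.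
  Since the polynomials are palindromic, \<open>P\<^sub>n(z) / (z A\<^sub>n\<^sub>-\<^sub>2(z))\<close> is a function of
  \<open>w = z + 1/z\<close>. With \<open>s = - (r + 1/r) \<ge> 2\<close> it equals
  \<open>n (w + 2) / 2 - 1/2 (\<Sum>r. (w\<^sup>2 - 4) / (w + s)) + k\<close>. Its imaginary part is a
  nonzero multiple of that of \<open>w\<close>, and for real \<open>w > 0\<close> it is greater than
  \<open>n + k \<ge> 0\<close>. Finally, \<open>Re z > 0\<close> forces \<open>Re w > 0\<close>.
\<close>

section \<open>Descents under insertion and reversal\<close>

lemma perm_des_le: "perm_des m \<sigma> \<le> m"
proof -
  have "perm_des m \<sigma> \<le> card {1..m}"
    unfolding perm_des_def by (rule card_mono) auto
  thus ?thesis by simp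
qed

text \<open>Precomposing a permutation of \<open>{1..N - 1}\<close> with \<open>insertion N p\<close> inserts the letter \<open>N\<close>
  right after position \<open>p\<close> of its one-line notation.\<close>

definition insertion :: "nat \<Rightarrow> nat \<Rightarrow> nat \<Rightarrow> nat" where
  "insertion N p i = (if i = p + 1 then N else if p + 1 < i \<and> i \<le> N then i - 1 else i)"

lemma insertion_permutes:
  assumes "p < N"
  shows "insertion N p permutes {1..N}"
proof (rule bij_imp_permutes)
  have inj: "inj_on (insertion N p) {1..N}"
    by (auto simp: inj_on_def insertion_def split: if_splits)
  moreover have "insertion N p ` {1..N} \<subseteq> {1..N}"
    using assms by (auto simp: insertion_def)
  ultimately show "bij_betw (insertion N p) {1..N} {1..N}"
    by (simp add: bij_betw_def endo_inj_surj)
qed (use assms in \<open>auto simp: insertion_def\<close>)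

text \<open>The largest letter of the result sits at position \<open>p + 1\<close>, so
  \<open>p\<close> can be read off and \<open>\<sigma>\<close> recovered. Surjectivity then follows
  by counting.\<close>

lemma insertion_bij:
  "bij_betw (\<lambda>(\<sigma>, p). \<sigma> \<circ> insertion (N + 1) p)
     ({\<sigma>. \<sigma> permutes {1..N}} \<times> {..N}) {\<tau>. \<tau> permutes {1..N + 1}}"
proof -
  let ?A = "{\<sigma>. \<sigma> permutes {1..N}} \<times> {..N}" and ?B = "{\<tau>. \<tau> permutes {1..N + 1}}"
  let ?f = "\<lambda>(\<sigma>, p). \<sigma> \<circ> insertion (N + 1) p"
  have sub: "?f ` ?A \<subseteq> ?B"
  proof (rule image_subsetI)
    fix x assume "x \<in> ?A"
    then obtain \<sigma> p where x: "x = (\<sigma>, p)" and \<sigma>: "\<sigma> permutes {1..N}" and p: "p \<le> N" by auto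
    have "insertion (N + 1) p permutes {1..N + 1}" using p by (intro insertion_permutes) simp
    moreover have "\<sigma> permutes {1..N + 1}" using \<sigma> by (rule permutes_subset) simp
    ultimately show "?f x \<in> ?B" by (simp add: x permutes_compose del: One_nat_def)
  qed
  have inj: "inj_on ?f ?A"
  proof (rule inj_onI, clarsimp)
    fix \<sigma> p \<sigma>' p'
    assume s: "\<sigma> permutes {Suc 0..N}" "\<sigma>' permutes {Suc 0..N}" and p: "p \<le> N" "p' \<le> N"
      and eq: "\<sigma> \<circ> insertion (Suc N) p = \<sigma>' \<circ> insertion (Suc N) p'"
    have fixed: "\<sigma> (Suc N) = Suc N" "\<sigma>' (Suc N) = Suc N"
      using s by (auto intro: permutes_not_in)
    have c: "insertion (Suc N) p permutes {1..Suc N}" "insertion (Suc N) p' permutes {1..Suc N}"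
      using p insertion_permutes[of p "Suc N"] insertion_permutes[of p' "Suc N"] by auto
    \<comment> \<open>Both sides are the largest letter \<open>Suc N\<close>; via \<open>eq\<close>,
      the left one is its occurrence at position \<open>p + 1\<close>.\<close>
    have "\<sigma>' (insertion (Suc N) p' (p + 1)) = \<sigma>' (insertion (Suc N) p' (p' + 1))"
      using fun_cong[OF eq, of "p + 1"] fixed by (simp add: insertion_def)
    hence "insertion (Suc N) p' (p + 1) = insertion (Suc N) p' (p' + 1)"
      using permutes_inj[OF s(2)] by (simp add: inj_eq)
    hence pp: "p = p'" using permutes_inj[OF c(2)] by (simp add: inj_eq)
    moreover have "\<sigma> = \<sigma>'"
    proof
      fix x
      obtain y where "insertion (Suc N) p y = x"
        using permutes_surj[OF c(1)] by (metis surjD)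
      thus "\<sigma> x = \<sigma>' x" using fun_cong[OF eq, of y] pp by simp
    qed
    ultimately show "\<sigma> = \<sigma>' \<and> p = p'" by simp
  qed
  have "card ?A = card ?B"
    by (simp add: card_cartesian_product card_permutations[OF refl])
  hence "?f ` ?A = ?B"
    using sub inj by (intro card_subset_eq) (auto simp: card_image finite_permutations)
  with inj show ?thesis by (simp add: bij_betw_def)
qed

text \<open>The new letter exceeds its neighbours: it is preceded by an ascent and followed by a
  descent, unless it comes last. If \<open>p\<close> was a descent, that one is destroyed and the
  count does not change.\<close>

lemma perm_des_insertion:
  assumes \<sigma>: "\<sigma> permutes {1..m + 1}" and p: "p \<le> m + 1"
  shows "perm_des (m + 1) (\<sigma> \<circ> insertion (m + 2) p) =
    (if p = m + 1 \<or> p \<in> {i \<in> {1..m}. \<sigma> i > \<sigma> (i + 1)} then perm_des m \<sigma> else perm_des m \<sigma> + 1)"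
proof -
  let ?c = "insertion (m + 2) p"
  define D where "D = {i \<in> {1..m}. \<sigma> i > \<sigma> (i + 1)}"
  have top: "\<sigma> (m + 2) = m + 2" using \<sigma> by (auto intro: permutes_not_in)
  have less: "\<sigma> i < m + 2" if "i \<in> {1..m + 1}" for i
    using permutes_in_image[OF \<sigma>, of i] that by auto
  \<comment> \<open>Descents before \<open>p\<close> stay, those after \<open>p\<close> move one
    place to the right, and \<open>p\<close> itself becomes an ascent.\<close>
  have D: "{i \<in> {1..m + 1}. (\<sigma> \<circ> ?c) i > (\<sigma> \<circ> ?c) (i + 1)} =
     (D \<inter> {..<p}) \<union> (if p \<le> m then {p + 1} else {}) \<union> Suc ` (D \<inter> {p<..})" (is "?L = ?R")
  proof (rule set_eqI)
    fix i
    consider "i \<notin> {1..m + 1}" | "1 \<le> i" "i < p" "i \<le> m" | "i = p" "1 \<le> i"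
      | "i = p + 1" "p \<le> m" | "i > p + 1" "i \<le> m + 1"
      using p by fastforce
    thus "i \<in> ?L \<longleftrightarrow> i \<in> ?R"
    proof cases
      case 1 thus ?thesis using p by (auto simp: D_def)
    next
      case 2 thus ?thesis by (auto simp: D_def insertion_def)
    next
      case 3
      hence "\<sigma> i < m + 2" using less[of i] p by auto
      thus ?thesis using 3 top by (auto simp: insertion_def)
    next
      case 4
      hence "\<sigma> i < m + 2" using less[of i] by auto
      thus ?thesis using 4 top by (auto simp: insertion_def)
    next
      case 5
      then obtain j where "i = Suc j" "p < j" by (cases i) auto
      thus ?thesis using 5 by (auto simp: D_def insertion_def image_iff)
    qed
  qed
  have fin: "finite D" by (simp add: D_def)
  have "card ?R = card (D \<inter> {..<p}) + (if p \<le> m then 1 else 0) + card (D \<inter> {p<..})"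
    using fin by (subst card_Un_disjoint, auto)+ (auto simp: card_image)
  moreover have "card D = card (D \<inter> {..<p}) + (if p \<in> D then 1 else 0) + card (D \<inter> {p<..})"
  proof -
    have "D = (D \<inter> {..<p}) \<union> (if p \<in> D then {p} else {}) \<union> (D \<inter> {p<..})"
      by (auto simp: not_less le_less)
    hence "card D = card \<dots>" by (rule arg_cong)
    also have "\<dots> = card (D \<inter> {..<p}) + (if p \<in> D then 1 else 0) + card (D \<inter> {p<..})"
      using fin by (subst card_Un_disjoint, auto)+
    finally show ?thesis .
  qed
  moreover have "p \<le> m" if "p \<in> D" using that by (auto simp: D_def)
  ultimately show ?thesis
    using p unfolding perm_des_def D D_def[symmetric] by auto
qed

text \<open>Of the \<open>m + 2\<close> gaps, the descents and the final gap preserve the descent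
  number; all others raise it by one.\<close>

lemma sum_perm_des_insertion:
  fixes g :: "nat \<Rightarrow> 'a :: comm_semiring_1"
  shows "(\<Sum>\<tau> | \<tau> permutes {1..m + 2}. g (perm_des (m + 1) \<tau>)) =
    (\<Sum>\<sigma> | \<sigma> permutes {1..m + 1}. of_nat (perm_des m \<sigma> + 1) * g (perm_des m \<sigma>)
       + of_nat (m + 1 - perm_des m \<sigma>) * g (perm_des m \<sigma> + 1))"
proof -
  have "(\<Sum>\<tau> | \<tau> permutes {1..m + 2}. g (perm_des (m + 1) \<tau>)) =
    (\<Sum>(\<sigma>, p) \<in> {\<sigma>. \<sigma> permutes {1..m + 1}} \<times> {..m + 1}.
       g (perm_des (m + 1) (\<sigma> \<circ> insertion (m + 2) p)))"
    using sum.reindex_bij_betw[OF insertion_bij[of "m + 1"], of "\<lambda>\<tau>. g (perm_des (m + 1) \<tau>)"]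
    by (simp add: case_prod_unfold)
  also have "\<dots> = (\<Sum>\<sigma> | \<sigma> permutes {1..m + 1}. \<Sum>p\<le>m + 1.
       g (perm_des (m + 1) (\<sigma> \<circ> insertion (m + 2) p)))"
    by (simp only: sum.cartesian_product)
  also have "\<dots> = (\<Sum>\<sigma> | \<sigma> permutes {1..m + 1}. of_nat (perm_des m \<sigma> + 1) * g (perm_des m \<sigma>)
       + of_nat (m + 1 - perm_des m \<sigma>) * g (perm_des m \<sigma> + 1))"
  proof (rule sum.cong[OF refl])
    fix \<sigma> assume "\<sigma> \<in> {\<sigma>. \<sigma> permutes {1..m + 1}}"
    hence \<sigma>: "\<sigma> permutes {1..m + 1}" by simp
    let ?d = "perm_des m \<sigma>"
    define E where "E = insert (m + 1) {i \<in> {1..m}. \<sigma> i > \<sigma> (i + 1)}"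
    have E: "E \<subseteq> {..m + 1}" "card E = ?d + 1"
      by (auto simp: E_def perm_des_def)
    have "(\<Sum>p\<le>m + 1. g (perm_des (m + 1) (\<sigma> \<circ> insertion (m + 2) p))) =
      (\<Sum>p\<le>m + 1. if p \<in> E then g ?d else g (?d + 1))"
      by (rule sum.cong) (auto simp: perm_des_insertion[OF \<sigma>, simplified] E_def)
    also have "\<dots> = of_nat (card ({..m + 1} \<inter> E)) * g ?d + of_nat (card ({..m + 1} - E)) * g (?d + 1)"
      by (subst sum.If_cases) (auto simp: Diff_eq)
    also have "{..m + 1} \<inter> E = E" using E by auto
    also have "card ({..m + 1} - E) = m + 1 - ?d"
      using E by (subst card_Diff_subset) (auto intro: finite_subset)
    finally show "(\<Sum>p\<le>m + 1. g (perm_des (m + 1) (\<sigma> \<circ> insertion (m + 2) p))) =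
      of_nat (?d + 1) * g ?d + of_nat (m + 1 - ?d) * g (?d + 1)"
      by (simp add: E(2) comp_def)
  qed
  finally show ?thesis .
qed

text \<open>Reversal turns an ascent at \<open>i\<close> into a descent at \<open>m + 1 - i\<close>,
  and every non-descent is a strict ascent by injectivity.\<close>

lemma perm_des_reverse:
  assumes \<sigma>: "\<sigma> permutes {1..m + 1}"
    and \<rho>: "\<And>i. i \<in> {1..m + 1} \<Longrightarrow> \<rho> i = m + 2 - i"
  shows "perm_des m (\<sigma> \<circ> \<rho>) = m - perm_des m \<sigma>"
proof -
  let ?D = "{i \<in> {1..m}. \<sigma> i > \<sigma> (i + 1)}"
  have "bij_betw (\<lambda>i. m + 1 - i) ({1..m} - ?D) {i \<in> {1..m}. (\<sigma> \<circ> \<rho>) i > (\<sigma> \<circ> \<rho>) (i + 1)}"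
  proof (rule bij_betwI[where g = "\<lambda>i. m + 1 - i"])
    have ne: "\<sigma> i \<noteq> \<sigma> (Suc i)" for i
      using permutes_inj[OF \<sigma>] by (simp add: inj_eq)
    show "(\<lambda>i. m + 1 - i) \<in> {1..m} - ?D \<rightarrow> {i \<in> {1..m}. (\<sigma> \<circ> \<rho>) i > (\<sigma> \<circ> \<rho>) (i + 1)}"
    proof
      fix i assume "i \<in> {1..m} - ?D"
      thus "m + 1 - i \<in> {i \<in> {1..m}. (\<sigma> \<circ> \<rho>) i > (\<sigma> \<circ> \<rho>) (i + 1)}"
        using ne[of i] by (auto simp: \<rho> Suc_diff_le)
    qed
    show "(\<lambda>i. m + 1 - i) \<in> {i \<in> {1..m}. (\<sigma> \<circ> \<rho>) i > (\<sigma> \<circ> \<rho>) (i + 1)} \<rightarrow> {1..m} - ?D"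
      by (auto simp: \<rho> Suc_diff_le)
  qed auto
  hence "perm_des m (\<sigma> \<circ> \<rho>) = card ({1..m} - ?D)"
    unfolding perm_des_def by (rule bij_betw_same_card[symmetric])
  also have "\<dots> = m - perm_des m \<sigma>"
    unfolding perm_des_def by (subst card_Diff_subset) auto
  finally show ?thesis .
qed

text \<open>With \<open>g\<close> arbitrary, this yields palindromicity both for the polynomial and
  for its derivative.\<close>

lemma sum_perm_des_reverse:
  "(\<Sum>\<sigma> | \<sigma> permutes {1..m + 1}. g (perm_des m \<sigma>)) =
   (\<Sum>\<sigma> | \<sigma> permutes {1..m + 1}. g (m - perm_des m \<sigma>))"
proof -
  define \<rho> where "\<rho> i = (if i \<in> {1..m + 1} then m + 2 - i else i)" for i
  have \<rho>: "\<rho> permutes {1..m + 1}"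
  proof (rule bij_imp_permutes)
    show "bij_betw \<rho> {1..m + 1} {1..m + 1}"
      by (rule bij_betwI[where g = \<rho>]) (auto simp: \<rho>_def)
  qed (auto simp: \<rho>_def)
  have "(\<Sum>\<sigma> | \<sigma> permutes {1..m + 1}. g (perm_des m \<sigma>)) =
    (\<Sum>\<sigma> | \<sigma> permutes {1..m + 1}. g (perm_des m (\<sigma> \<circ> \<rho>)))"
    by (rule sum_permutations_compose_right[OF \<rho>])
  also have "\<dots> = (\<Sum>\<sigma> | \<sigma> permutes {1..m + 1}. g (m - perm_des m \<sigma>))"
    by (rule sum.cong[OF refl], subst perm_des_reverse) (simp_all add: \<rho>_def)
  finally show ?thesis .
qed

section \<open>Eulerian polynomials\<close>

lemma poly_eulerian_poly:
  "poly (eulerian_poly m) x = (\<Sum>\<sigma> | \<sigma> permutes {1..m + 1}. x ^ perm_des m \<sigma>)"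
  by (simp add: eulerian_poly_def poly_sum poly_monom)

text \<open>The factor \<open>x\<close> restores the exponent \<open>d\<close>, so that
  \<open>d = 0\<close> needs no separate treatment later.\<close>

lemma poly_pderiv_eulerian_poly:
  fixes x :: "'a :: idom"
  shows "x * poly (pderiv (eulerian_poly m)) x =
    (\<Sum>\<sigma> | \<sigma> permutes {1..m + 1}. of_nat (perm_des m \<sigma>) * x ^ perm_des m \<sigma>)"
proof -
  have "x * poly (pderiv (monom 1 d)) x = of_nat d * x ^ d" for d
    by (cases d) (auto simp: pderiv_monom poly_monom)
  thus ?thesis by (simp add: eulerian_poly_def higher_pderiv_sum[of 1, simplified] poly_sum sum_distrib_left)
qed

lemma poly_eulerian_poly_Suc:
  fixes x :: "'a :: idom"
  shows "poly (eulerian_poly (m + 1)) x =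
    (1 + of_nat (m + 1) * x) * poly (eulerian_poly m) x
      + (1 - x) * (x * poly (pderiv (eulerian_poly m)) x)"
proof -
  let ?P = "{\<sigma>. \<sigma> permutes {1..m + 1}}"
  \<comment> \<open>The recurrence holds already for the contribution of a single permutation;
    \<open>d \<le> m\<close> keeps the natural subtraction exact.\<close>
  have key: "of_nat (d + 1) * x ^ d + of_nat (m + 1 - d) * x ^ (d + 1) =
     (1 + of_nat (m + 1) * x) * x ^ d + (1 - x) * (of_nat d * x ^ d)" if "d \<le> m" for d
    using that by (simp add: of_nat_diff algebra_simps)
  have "poly (eulerian_poly (m + 1)) x = (\<Sum>\<tau> | \<tau> permutes {1..m + 2}. x ^ perm_des (m + 1) \<tau>)"
    by (simp add: poly_eulerian_poly)
  also have "\<dots> = (\<Sum>\<sigma>\<in>?P. (1 + of_nat (m + 1) * x) * x ^ perm_des m \<sigma>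
      + (1 - x) * (of_nat (perm_des m \<sigma>) * x ^ perm_des m \<sigma>))"
    by (simp only: sum_perm_des_insertion key[OF perm_des_le])
  finally show ?thesis
    by (simp only: poly_eulerian_poly poly_pderiv_eulerian_poly sum.distrib sum_distrib_left)
qed

lemma poly_pderiv_eulerian_poly_reverse:
  fixes z :: "'a :: field"
  assumes "z \<noteq> 0"
  shows "z * poly (pderiv (eulerian_poly m)) z = z ^ m * (of_nat m * poly (eulerian_poly m) (1 / z)
     - 1 / z * poly (pderiv (eulerian_poly m)) (1 / z))"
proof -
  have "of_nat (m - d) * z ^ (m - d) =
      z ^ m * (of_nat m * (1 / z) ^ d - of_nat d * (1 / z) ^ d)" if "d \<le> m" for d
    using that assms by (simp add: of_nat_diff power_diff field_simps)
  thus ?thesis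
    unfolding poly_pderiv_eulerian_poly poly_eulerian_poly
    using sum_perm_des_reverse[of "\<lambda>d. of_nat d * z ^ d" m]
    by (simp add: sum_distrib_left sum_subtractf[symmetric] perm_des_le)
qed

lemma poly_eulerian_poly_reverse:
  fixes z :: "'a :: field"
  assumes "z \<noteq> 0"
  shows "poly (eulerian_poly m) z = z ^ m * poly (eulerian_poly m) (1 / z)"
proof -
  have "z ^ (m - d) = z ^ m * (1 / z) ^ d" if "d \<le> m" for d
    using that assms by (simp add: power_diff field_simps)
  thus ?thesis
    unfolding poly_eulerian_poly using sum_perm_des_reverse[of "\<lambda>d. z ^ d" m]
    by (simp add: sum_distrib_left perm_des_le)
qed

lemma degree_eulerian_poly_le: "degree (eulerian_poly m) \<le> m"
  unfolding eulerian_poly_def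
  by (rule degree_sum_le) (auto intro: order_trans[OF degree_monom_le] perm_des_le finite_permutations)

text \<open>The identity permutation contributes the constant term 1; this excludes nonnegative real
  roots.\<close>

lemma poly_eulerian_poly_pos:
  fixes x :: real
  assumes "x \<ge> 0"
  shows "poly (eulerian_poly m) x > 0"
  unfolding poly_eulerian_poly
proof (rule sum_pos2[where i = id])
  have "perm_des m id = 0" by (auto simp: perm_des_def)
  thus "x ^ perm_des m id > 0" by simp
qed (use assms in \<open>auto simp: finite_permutations permutes_id\<close>)

lemma poly_eulerian_poly_of_real:
  "poly (eulerian_poly m) (complex_of_real x) = of_real (poly (eulerian_poly m) x)"
  by (simp add: poly_eulerian_poly)

section \<open>Real-rootedness through the logarithmic derivative\<close>

lemma log_deriv_poly_prod:
  fixes z :: "'a :: field_char_0" and d :: nat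
  assumes f: "f = smult c (\<Prod>i<d. [:- a i, 1:])" and nz: "poly f z \<noteq> 0"
  shows "poly (pderiv f) z = poly f z * (\<Sum>i<d. 1 / (z - a i))"
proof -
  have "z - a i \<noteq> 0" if "i < d" for i
    using nz that prod_zero_iff[of "{..<d}" "\<lambda>i. z - a i"] by (auto simp: f poly_prod)
  hence "(\<Prod>j\<in>{..<d} - {i}. z - a j) = (\<Prod>j<d. z - a j) / (z - a i)" if "i < d" for i
    using that by (subst prod.remove[of "{..<d}" i]) auto
  thus ?thesis
    by (simp add: f pderiv_smult pderiv_prod poly_sum poly_prod pderiv_pCons sum_distrib_left)
qed

lemma eulerian_poly_real_rooted:
  assumes "poly (eulerian_poly m) z = 0"
  shows "z \<in> \<real> \<and> Re z < 0"
  using assms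
proof (induction m arbitrary: z)
  case 0
  show ?case using 0 by (simp add: poly_eulerian_poly perm_des_def)
next
  case (Suc m)
  let ?f = "eulerian_poly m :: complex poly"
  have "Im z = 0"
  proof (rule ccontr)
    assume im: "Im z \<noteq> 0"
    obtain a where a: "smult (lead_coeff ?f) (\<Prod>i<degree ?f. [:- a i, 1:]) = ?f"
      using complex_poly_decompose' by blast
    let ?d = "degree ?f"
    have root: "a i \<in> \<real> \<and> Re (a i) < 0" if "i < ?d" for i
    proof (rule Suc.IH)
      show "poly ?f (a i) = 0"
        by (subst a[symmetric]) (use that in \<open>auto simp: poly_prod\<close>)
    qed
    have fz: "poly ?f z \<noteq> 0"
      using Suc.IH[of z] im by (auto simp: complex_is_Real_iff)
    have z: "z \<noteq> 0" using im by auto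
    have za: "z \<noteq> a i" if "i < ?d" for i
      using root[OF that] im by (auto simp: complex_is_Real_iff)
    \<comment> \<open>This is \<open>A\<^sub>m\<^sub>+\<^sub>1(z) / (z A\<^sub>m(z))\<close>. Each
      fraction \<open>(1 - a i) / (z - a i)\<close> hides a summand 1, hence the correction by
      \<open>?d\<close> in the constant.\<close>
    let ?B = "1 / z + of_real (real m + 1 - real ?d) + (\<Sum>i<?d. (1 - a i) / (z - a i))"
    have "(1 - a i) / (z - a i) = 1 + (1 - z) * (1 / (z - a i))" if "i < ?d" for i
      using za[OF that] by (simp add: field_simps)
    hence S: "(\<Sum>i<?d. (1 - a i) / (z - a i)) = of_nat ?d + (1 - z) * (\<Sum>i<?d. 1 / (z - a i))"
      by (simp add: sum.distrib sum_distrib_left)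
    have B: "z * ?B = 1 + of_nat (m + 1) * z + (1 - z) * (z * (\<Sum>i<?d. 1 / (z - a i)))"
      using z unfolding S by (simp add: algebra_simps)
    have "poly ?f z * (z * ?B) = poly (eulerian_poly (m + 1)) z"
      unfolding B poly_eulerian_poly_Suc log_deriv_poly_prod[OF a[symmetric] fz]
      by (simp add: algebra_simps)
    also have "\<dots> = 0" using Suc.prems by simp
    finally have "?B = 0" using fz z by simp
    \<comment> \<open>Real numerators and denominators with the same imaginary part make all
      fractions contribute with the same sign.\<close>
    have Im_div: "Im (u / v) = - Im z * (Re u / (cmod v)\<^sup>2)" if "Im u = 0" "Im v = Im z" for u v
      using that by (simp add: Im_divide cmod_def)
    have "Im ?B = - Im z * (1 / (cmod z)\<^sup>2 + (\<Sum>i<?d. (1 - Re (a i)) / (cmod (z - a i))\<^sup>2))"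
    proof -
      have "Im ((1 - a i) / (z - a i)) = - Im z * ((1 - Re (a i)) / (cmod (z - a i))\<^sup>2)" if "i < ?d" for i
        using root[OF that] by (subst Im_div) (auto simp: complex_is_Real_iff)
      moreover have "Im (1 / z) = - Im z * (1 / (cmod z)\<^sup>2)"
        by (subst Im_div) auto
      ultimately show ?thesis
        by (simp add: Im_sum sum_distrib_left distrib_left sum_negf)
    qed
    moreover have "1 - Re (a i) \<ge> 0" if "i < ?d" for i
      using root[OF that] by simp
    hence "1 / (cmod z)\<^sup>2 + (\<Sum>i<?d. (1 - Re (a i)) / (cmod (z - a i))\<^sup>2) > 0"
      using z by (intro add_pos_nonneg sum_nonneg divide_nonneg_nonneg) auto
    ultimately have "Im ?B \<noteq> 0" using im by simp
    with \<open>?B = 0\<close> show False by simp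
  qed
  hence "z = of_real (Re z)" by (simp add: complex_eq_iff)
  with Suc.prems have "poly (eulerian_poly (Suc m)) (Re z) = 0"
    by (metis of_real_eq_0_iff poly_eulerian_poly_of_real)
  hence "Re z < 0" using poly_eulerian_poly_pos[of "Re z" "Suc m"] by fastforce
  with \<open>Im z = 0\<close> show ?case by (simp add: complex_is_Real_iff)
qed

section \<open>Stability\<close>

text \<open>With \<open>f = A\<^sub>m\<close>, averaging \<open>z f'(z) / f(z)\<close> with the expression
  \<open>m - (1/z) f'(1/z) / f(1/z)\<close>, equal to it by palindromicity, makes the partial fractions
  depend on \<open>z\<close> through \<open>w\<close> only, up to the factor \<open>z - 1/z\<close>.\<close>

lemma poly_eulerian_poly_Suc_joukowski:
  fixes z :: complex
  assumes z: "Re z > 0" and w: "w = z + 1 / z"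
  obtains d :: nat and s :: "nat \<Rightarrow> real"
  where "d \<le> m" "\<And>i. i < d \<Longrightarrow> s i \<ge> 2"
    "2 * (z + 1) * poly (eulerian_poly (m + 1)) z = z * poly (eulerian_poly m) z *
       (of_nat (m + 2) * (w + 2) - (\<Sum>i<d. (w\<^sup>2 - 4) / (w + of_real (s i))))"
proof -
  let ?f = "eulerian_poly m :: complex poly"
  obtain a where a: "smult (lead_coeff ?f) (\<Prod>i<degree ?f. [:- a i, 1:]) = ?f"
    using complex_poly_decompose' by blast
  let ?d = "degree ?f"
  \<comment> \<open>Up to sign, the value of \<open>w\<close> at the root \<open>a i\<close>; for a
    negative root the bound 2 is the AM-GM inequality.\<close>
  define s where "s i = - (Re (a i) + 1 / Re (a i))" for i
  have root: "a i = of_real (Re (a i)) \<and> Re (a i) < 0" if "i < ?d" for i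
  proof -
    have "poly ?f (a i) = 0"
      by (subst a[symmetric]) (use that in \<open>auto simp: poly_prod\<close>)
    from eulerian_poly_real_rooted[OF this] show ?thesis by (simp add: complex_is_Real_iff complex_eq_iff)
  qed
  have s2: "s i \<ge> 2" if "i < ?d" for i
  proof -
    have "Re (a i) < 0" using root[OF that] by simp
    moreover have "(Re (a i) + 1)\<^sup>2 \<ge> 0" by simp
    ultimately show ?thesis by (simp add: s_def field_simps power2_eq_square)
  qed
  have z0: "z \<noteq> 0" using z by auto
  have z1: "Re (1 / z) > 0"
    using z by (simp add: Re_divide sum_power2_gt_zero_iff)
  have fz: "poly ?f z \<noteq> 0" "poly ?f (1 / z) \<noteq> 0"
    using eulerian_poly_real_rooted[of m z] eulerian_poly_real_rooted[of m "1 / z"] z z1 by fastforce+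
  let ?L = "\<lambda>z. \<Sum>i<?d. 1 / (z - a i)"
  have "poly ?f z * (z * ?L z) = z ^ m * poly ?f (1 / z) * (of_nat m - 1 / z * ?L (1 / z))"
    using poly_pderiv_eulerian_poly_reverse[OF z0, of m]
    unfolding log_deriv_poly_prod[OF a[symmetric] fz(1)] log_deriv_poly_prod[OF a[symmetric] fz(2)]
    by (simp add: algebra_simps)
  \<comment> \<open>Palindromicity lets the two values of \<open>?f\<close> cancel.\<close>
  hence zL: "z * ?L z = of_nat m - 1 / z * ?L (1 / z)"
    using fz(1) by (simp flip: poly_eulerian_poly_reverse[OF z0])
  define S where "S = (\<Sum>i<?d. 1 / (w + of_real (s i)))"
  have "z * ?L z - 1 / z * ?L (1 / z) = (\<Sum>i<?d. z / (z - a i) - (1 / z) / (1 / z - a i))"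
    by (simp add: sum_distrib_left sum_subtractf)
  also have "\<dots> = (\<Sum>i<?d. (z - 1 / z) * (1 / (w + of_real (s i))))"
  proof (rule sum.cong[OF refl])
    fix i assume "i \<in> {..<?d}"
    hence r: "a i = of_real (Re (a i))" "Re (a i) < 0" using root by auto
    \<comment> \<open>This rules out \<open>z * a i = 1\<close>, the case where \<open>1 / z\<close>
      is a root.\<close>
    have "Re (z * a i) < 0"
      by (subst r(1)) (use z r(2) in \<open>simp add: mult_pos_neg\<close>)
    hence nz: "a i \<noteq> 0" "z - a i \<noteq> 0" "1 - z * a i \<noteq> 0"
      using z r(2) by (auto simp del: times_complex.sel)
    have s_a: "of_real (s i) = - (a i + 1 / a i)"
      by (subst (1 2) r(1)) (simp add: s_def)
    \<comment> \<open>As a function of \<open>z\<close>, \<open>w + s i\<close> vanishes exactly at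
      \<open>a i\<close> and its reciprocal, which explains the factors.\<close>
    have ws: "w + of_real (s i) = (z - a i) * (1 - z * a i) / (- z * a i)"
    proof -
      have "z + 1 / z + - (u + 1 / u) = (z - u) * (1 - z * u) / (- z * u)" if "u \<noteq> 0" for u
        using that z0 by (simp add: divide_simps) (simp add: algebra_simps)
      from this[OF nz(1)] show ?thesis by (simp only: w s_a)
    qed
    have "(1 / z) / (1 / z - a i) = 1 / (1 - z * a i)"
      using z0 by (simp add: right_diff_distrib)
    hence "z / (z - a i) - (1 / z) / (1 / z - a i) =
        (z * (1 - z * a i) - (z - a i)) / ((z - a i) * (1 - z * a i))"
      using diff_frac_eq[OF nz(2,3), of z 1] by (simp only: mult_1)
    also have "z * (1 - z * a i) - (z - a i) = (z - 1 / z) * (- z * a i)"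
      using z0 by (simp add: algebra_simps)
    finally show "z / (z - a i) - (1 / z) / (1 / z - a i) = (z - 1 / z) * (1 / (w + of_real (s i)))"
      unfolding ws by simp
  qed
  also have "\<dots> = (z - 1 / z) * S" by (simp add: S_def sum_distrib_left)
  finally have diff: "z * ?L z - 1 / z * ?L (1 / z) = (z - 1 / z) * S" .
  have "2 * x = b + t" if "x - y = t" "x = b - y" for b t x y :: complex
    unfolding that(1)[symmetric] that(2) by (simp add: algebra_simps)
  from this[OF diff zL] have L: "2 * (z * ?L z) = of_nat m + (z - 1 / z) * S" .
  have "2 * (z + 1) * poly (eulerian_poly (m + 1)) z =
      poly ?f z * (z + 1) * (2 * (1 + of_nat (m + 1) * z) + (1 - z) * (2 * (z * ?L z)))"
    unfolding poly_eulerian_poly_Suc log_deriv_poly_prod[OF a[symmetric] fz(1)]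
    by (simp add: algebra_simps)
  \<comment> \<open>Uses \<open>(z + 1)\<^sup>2 = z (w + 2)\<close> and
    \<open>(z - 1/z)\<^sup>2 = w\<^sup>2 - 4\<close>; the factor \<open>z + 1\<close> was introduced
    to complete both squares.\<close>
  also have "\<dots> = z * poly ?f z * (of_nat (m + 2) * (w + 2) - (w\<^sup>2 - 4) * S)"
    unfolding L using z0 by (simp add: w field_simps power2_eq_square)
  also have "(w\<^sup>2 - 4) * S = (\<Sum>i<?d. (w\<^sup>2 - 4) / (w + of_real (s i)))"
    by (simp add: S_def sum_distrib_left)
  finally show ?thesis using that[of ?d s] degree_eulerian_poly_le s2 by blast
qed

lemma joukowski_quotient_sum_neq:
  fixes w :: complex and s :: "nat \<Rightarrow> real"
  assumes w: "Re w > 0" and d: "d \<le> m" and s: "\<And>i. i < d \<Longrightarrow> s i \<ge> 2" and k: "k \<ge> - real (m + 2)"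
  shows "of_nat (m + 2) * (w + 2) - (\<Sum>i<d. (w\<^sup>2 - 4) / (w + of_real (s i))) + 2 * of_real k \<noteq> 0"
    (is "?F \<noteq> 0")
proof
  assume F: "?F = 0"
  have nz: "w + of_real (s i) \<noteq> 0" if "i < d" for i
    using w s[OF that] by (auto simp: complex_eq_iff)
  \<comment> \<open>Division with remainder: the remainder \<open>s\<^sup>2 - 4\<close> is
    nonnegative, so each quotient has imaginary part at most 1 times \<open>Im w\<close> in the
    direction of \<open>Im w\<close>.\<close>
  have quot: "(w\<^sup>2 - 4) / (w + of_real (s i)) =
      w - of_real (s i) + of_real ((s i)\<^sup>2 - 4) / (w + of_real (s i))" if "i < d" for i
    using nz[OF that] by (simp add: field_simps power2_eq_square)
  have s4: "(s i)\<^sup>2 - 4 \<ge> 0" if "i < d" for i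
    using power_mono[OF s[OF that], of 2] by simp
  let ?Q = "\<Sum>i<d. ((s i)\<^sup>2 - 4) / (cmod (w + of_real (s i)))\<^sup>2"
  have "Im ((w\<^sup>2 - 4) / (w + of_real (s i))) =
      Im w * (1 - ((s i)\<^sup>2 - 4) / (cmod (w + of_real (s i)))\<^sup>2)" if "i < d" for i
    unfolding quot[OF that] by (simp add: Im_divide cmod_def algebra_simps flip: add_divide_distrib)
  hence "Im (\<Sum>i<d. (w\<^sup>2 - 4) / (w + of_real (s i))) = Im w * (real d - ?Q)"
    by (simp add: Im_sum sum_subtractf flip: sum_distrib_left)
  hence Im: "Im ?F = Im w * (real (m + 2) - real d + ?Q)"
    by (simp add: algebra_simps)
  \<comment> \<open>Strict because \<open>d \<le> m\<close> leaves at least 2.\<close>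
  have pos: "real (m + 2) - real d + ?Q > 0"
    using d s4 by (intro add_pos_nonneg sum_nonneg divide_nonneg_nonneg) auto
  have "Im w * (real (m + 2) - real d + ?Q) = 0" unfolding Im[symmetric] F by simp
  hence "Im w = 0" using pos by (simp only: mult_eq_0_iff) linarith
  then obtain x where x: "w = of_real x" "x > 0"
    using w by (metis complex_is_Real_iff Reals_cases Re_complex_of_real)
  have "?F = of_real (real (m + 2) * (x + 2) - (\<Sum>i<d. (x\<^sup>2 - 4) / (x + s i)) + 2 * k)"
    by (simp add: x)
  with F have "real (m + 2) * (x + 2) - (\<Sum>i<d. (x\<^sup>2 - 4) / (x + s i)) + 2 * k = 0"
    by (metis of_real_eq_0_iff)
  \<comment> \<open>For \<open>x > 0\<close>, clearing denominators reduces each summand to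
    \<open>-4 \<le> x * s i\<close>.\<close>
  moreover have "(\<Sum>i<d. (x\<^sup>2 - 4) / (x + s i)) \<le> (\<Sum>i<d. x)"
  proof (rule sum_mono)
    fix i assume "i \<in> {..<d}"
    hence "s i \<ge> 2" using s by simp
    hence "0 \<le> x * s i" "x + s i > 0" using x by simp_all
    thus "(x\<^sup>2 - 4) / (x + s i) \<le> x"
      by (simp add: pos_divide_le_eq algebra_simps power2_eq_square)
  qed
  moreover have "(\<Sum>i<d. x) < real (m + 2) * x" using d x by simp
  ultimately show False using k by (simp add: algebra_simps)
qed

theorem theorem2p3:
  fixes n :: nat and k :: real
  assumes "n \<ge> 2" and "k \<ge> - real n"
  shows "weakly_hurwitz_stable
    ([:1, 1:] * eulerian_poly (n - 1) + smult (complex_of_real k) ([:0, 1:] * eulerian_poly (n - 2)))"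
  unfolding weakly_hurwitz_stable_def
proof (intro allI impI notI)
  fix z :: complex
  let ?P = "[:1, 1:] * eulerian_poly (n - 1) + smult (complex_of_real k) ([:0, 1:] * eulerian_poly (n - 2))"
  assume z: "Re z > 0" and P: "poly ?P z = 0"
  obtain m where n: "n = m + 2" using assms(1) by (metis add.commute le_Suc_ex)
  define w where "w = z + 1 / z"
  obtain d s where ds: "d \<le> m" "\<And>i. i < d \<Longrightarrow> s i \<ge> 2"
    and eq: "2 * (z + 1) * poly (eulerian_poly (m + 1)) z = z * poly (eulerian_poly m) z *
      (of_nat (m + 2) * (w + 2) - (\<Sum>i<d. (w\<^sup>2 - 4) / (w + of_real (s i))))"
    using poly_eulerian_poly_Suc_joukowski[OF z w_def] by blast
  have "Re w > 0"
    using z by (simp add: w_def Re_divide add_pos_nonneg)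
  \<comment> \<open>The 2 accompanying \<open>k\<close> matches the doubling in \<open>eq\<close>,
    so the bracket is twice the quotient of \<open>?P\<close> by \<open>z A\<^sub>m\<close>.\<close>
  have "z * poly (eulerian_poly m) z * (of_nat (m + 2) * (w + 2)
      - (\<Sum>i<d. (w\<^sup>2 - 4) / (w + of_real (s i))) + 2 * of_real k) = 2 * poly ?P z"
    unfolding distrib_left[of _ _ "2 * of_real k"] eq[symmetric] by (simp add: n algebra_simps)
  moreover have "z * poly (eulerian_poly m) z \<noteq> 0"
    using z eulerian_poly_real_rooted[of m z] by fastforce
  ultimately have "of_nat (m + 2) * (w + 2) - (\<Sum>i<d. (w\<^sup>2 - 4) / (w + of_real (s i)))
      + 2 * of_real k = 0"
    unfolding P mult_zero_right by (simp only: mult_eq_0_iff) simp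
  thus False
    using joukowski_quotient_sum_neq[of w d m s k] ds \<open>Re w > 0\<close> assms(2) n by blast
qed

end
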